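(* Let $a>0$ be a differentiable function and $W'$ a function on an open interval. Suppose that the Riccati equation $$\frac{\mathrm dU}{\mathrm dx}+U^2+2W'(x)\,U=\frac{2\lambda}{a(x)}$$ has a solution $U(x,\lambda)$ expressible in the form $$U(x,\lambda)=u_0(x)+\cfrac{2\lambda/a(x)}{u_1(x)+\cfrac{2\lambda/a(x)}{u_2(x)+\cdots}} .$$ Then, for every $n=0,1,2,\ldots$, $u_n$ solves the homogeneous Riccati equation $$\frac{\mathrm du_n}{\mathrm dx}+u_n^2+2W_n'(x)\,u_n=0,$$ where $$W_0':=W',\qquad W_n'=\frac{a'}{2a}-u_{n-1}-W_{n-1}'\quad(n\ge1).$$
   Context: The Riccati equation arises from a one-dimensional diffusion with instantaneous variance $a$, instantaneous drift $b$ and $W'=b/a$, by setting $U=\phi'/\phi$ where $\frac a2e^{-2W}\frac{\mathrm d}{\mathrm dx}[e^{2W}\phi']=\lambda\phi$. Here $\lambda>0$ is a parameter, primes denote differentiation with respect to $x$, and "expressible in the form" means that there are functions $u_0,u_1,u_2,\ldots$ of $x$ alone (not depending on $\lambda$, of arbitrary sign) such that the infinite continued fraction equals $U(x,\lambda)$ for all $x$ and $\lambda$. The symbols $W_n'$ simply denote functions defined by the stated recurrence.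
   Formalization: The continued fraction is also assumed well defined near λ=0: for each x, no truncation divides by zero for all small λ>0 (so u_n≠0 for n≥1). Without this the claim fails, e.g. for (-5,0,5,1/x,3/x,…) with a=2, W'=0. *)

theory Defs
  imports "HOL-Analysis.Analysis"
begin

definition riccati_solution ::
  "real set \<Rightarrow> (real \<Rightarrow> real) \<Rightarrow> (real \<Rightarrow> real) \<Rightarrow> (real \<Rightarrow> real) \<Rightarrow> bool" where
  "riccati_solution I W' g u \<longleftrightarrow>
     (\<forall>x\<in>I. u differentiable (at x) \<and> deriv u x + (u x)\<^sup>2 + 2 * W' x * u x = g x)"

(* cf_trunc c z N is the nested expression c 0 + z / (c 1 + z / (... + z / c N)). *)
fun cf_trunc :: "(nat \<Rightarrow> real) \<Rightarrow> real \<Rightarrow> nat \<Rightarrow> real" where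
  "cf_trunc c z 0 = c 0"
| "cf_trunc c z (Suc N) = c 0 + z / cf_trunc (\<lambda>n. c (Suc n)) z N"

(* No division by zero occurs in cf_trunc c z N. This is needed because x / 0 = 0 in HOL. *)
fun cf_trunc_defined :: "(nat \<Rightarrow> real) \<Rightarrow> real \<Rightarrow> nat \<Rightarrow> bool" where
  "cf_trunc_defined c z 0 \<longleftrightarrow> True"
| "cf_trunc_defined c z (Suc N) \<longleftrightarrow>
     cf_trunc (\<lambda>n. c (Suc n)) z N \<noteq> 0 \<and> cf_trunc_defined (\<lambda>n. c (Suc n)) z N"

(* As usual for continued fractions, finitely many truncations may be undefined. *)
definition cf_has_value :: "(nat \<Rightarrow> real) \<Rightarrow> real \<Rightarrow> real \<Rightarrow> bool" where
  "cf_has_value c z v \<longleftrightarrow>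
     (\<forall>\<^sub>F N in sequentially. cf_trunc_defined c z N) \<and> cf_trunc c z \<longlonglongrightarrow> v"

(* U x l is, for all x in I and all l > 0, the value of the continued fraction with partial
   denominators u n x and partial numerators 2 l / a x. No sign is imposed on u n.

   The second conjunct says that the displayed expression is meaningful near l = 0: for each x,
   the parameters l at which some truncation divides by zero stay away from 0 (in particular
   u n x is nonzero for n > 0). Convergence alone would admit degenerate expansions: since
   p + z / (0 + z / (q + y)) = (p + q) + y, any value u 0 could be split arbitrarily into p + q. *)
definition cf_expressible ::
  "real set \<Rightarrow> (real \<Rightarrow> real) \<Rightarrow> (nat \<Rightarrow> real \<Rightarrow> real) \<Rightarrow> (real \<Rightarrow> real \<Rightarrow> real) \<Rightarrow> bool" where
  "cf_expressible I a u U \<longleftrightarrow>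
     (\<forall>x\<in>I. \<forall>l>0. cf_has_value (\<lambda>n. u n x) (2 * l / a x) (U x l)) \<and>
     (\<forall>x\<in>I. \<forall>\<^sub>F l in at_right 0. \<forall>N. cf_trunc_defined (\<lambda>n. u n x) (2 * l / a x) N)"

(* W_seq a W' u n is the function written W_n'; the prime is part of the name, as W' is not
   assumed to have an antiderivative. *)
fun W_seq ::
  "(real \<Rightarrow> real) \<Rightarrow> (real \<Rightarrow> real) \<Rightarrow> (nat \<Rightarrow> real \<Rightarrow> real) \<Rightarrow> nat \<Rightarrow> real \<Rightarrow> real" where
  "W_seq a W' u 0 x = W' x"
| "W_seq a W' u (Suc n) x = deriv a x / (2 * a x) - u n x - W_seq a W' u n x"

end

theory Submission
  imports Defs
begin

text \<open>
  Fix \<open>x\<close> and put \<open>z = 2 \<lambda> / a(x)\<close>. Since no truncation divides by zero for small \<open>z\<close>, every tail of every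
  truncation has a constant sign on an interval \<open>[0, d)\<close>, namely that of its leading coefficient.
  This bounds the tails away from \<open>0\<close> near \<open>z = 0\<close>, uniformly in the order of truncation, so that the
  tails \<open>U\<^sub>n\<close> of the infinite fraction satisfy \<open>U\<^sub>n\<^sub>+\<^sub>1 = z / (U\<^sub>n - u\<^sub>n)\<close> and \<open>U\<^sub>n \<longlongrightarrow> u\<^sub>n\<close> as \<open>\<lambda>\<close> tends to \<open>0\<close>.

  It remains to let \<open>\<lambda>\<close> tend to \<open>0\<close> in the Riccati equation of \<open>U\<^sub>n\<close>. The function \<open>W'\<close> is
  arbitrary, but where \<open>U\<^sub>n\<close> is nonzero the equation itself yields \<open>p > 0\<close> with \<open>p' = 2 W' p\<close>, and
  \<open>V = p U\<^sub>n\<close> satisfies \<open>V' = \<lambda> h - k V\<^sup>2\<close> with continuous \<open>h, k \<ge> 0\<close>, where dominated convergence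
  applies. Thus \<open>u\<^sub>n\<close> solves the homogeneous equation. The difference quotient \<open>p (U\<^sub>n - u\<^sub>n) / \<lambda>\<close>
  solves a linear equation with bounded coefficients and has a nonzero limit, so \<open>U\<^sub>n - u\<^sub>n\<close> has no
  zeros in a neighbourhood that does not depend on \<open>\<lambda>\<close>. There \<open>U\<^sub>n\<^sub>+\<^sub>1\<close> solves the next equation.
\<close>

section \<open>Tails of continued fractions near zero\<close>

lemma cf_trunc_0: "cf_trunc c 0 N = c 0"
  by (cases N) auto

text \<open>Tails starting at index 1 or later are the ones that occur as denominators. Nothing is
  claimed about the whole fraction, whose leading coefficient may be zero.\<close>

lemma cf_trunc_tail_nonzero:
  assumes "\<forall>N. cf_trunc_defined c z N"
  shows "cf_trunc (\<lambda>n. c (n + Suc k)) z N \<noteq> 0"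
  using assms
proof (induction k arbitrary: c)
  case 0
  then have "cf_trunc_defined c z (Suc N)" by blast
  then show ?case by simp
next
  case (Suc k)
  have "\<forall>N. cf_trunc_defined (\<lambda>n. c (Suc n)) z N"
    using Suc.prems cf_trunc_defined.simps(2) by blast
  from Suc.IH[OF this] show ?case by simp
qed

text \<open>The point \<open>z = 0\<close> is included: it makes the coefficients themselves nonzero
  and gives sign arguments a starting point.\<close>

definition cf_nonzero :: "(nat \<Rightarrow> real) \<Rightarrow> real \<Rightarrow> bool" where
  "cf_nonzero c d \<longleftrightarrow> (\<forall>k N z. 0 \<le> z \<longrightarrow> z < d \<longrightarrow> cf_trunc (\<lambda>n. c (n + k)) z N \<noteq> 0)"

lemma cf_nonzero_shift: "cf_nonzero c d \<Longrightarrow> cf_nonzero (\<lambda>n. c (n + j)) d"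
  unfolding cf_nonzero_def by (simp add: add.assoc)

lemma cf_nonzero_Suc: "cf_nonzero c d \<Longrightarrow> cf_nonzero (\<lambda>n. c (Suc n)) d"
  using cf_nonzero_shift[of c d 1] by simp

lemma cf_nonzeroD: "cf_nonzero c d \<Longrightarrow> 0 \<le> z \<Longrightarrow> z < d \<Longrightarrow> cf_trunc c z N \<noteq> 0"
  unfolding cf_nonzero_def by (metis (no_types, lifting) add_0_right ext)

lemma cf_nonzero_coeff: "cf_nonzero c d \<Longrightarrow> 0 < d \<Longrightarrow> c k \<noteq> 0"
  using cf_nonzeroD[OF cf_nonzero_shift[of c d k], of 0 0] by simp

lemma continuous_on_cf_trunc:
  assumes "cf_nonzero c d"
  shows "continuous_on {0..<d} (\<lambda>z. cf_trunc c z N)"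
  using assms
proof (induction N arbitrary: c)
  case 0
  then show ?case by simp
next
  case (Suc N)
  have *: "cf_nonzero (\<lambda>n. c (Suc n)) d" using Suc.prems by (rule cf_nonzero_Suc)
  show ?case
    using Suc.IH[OF *] cf_nonzeroD[OF *] by (auto intro!: continuous_intros)
qed

text \<open>At \<open>z = 0\<close> the truncation equals \<open>c 0\<close>, and a continuous
  function without zeros keeps its sign.\<close>

lemma cf_trunc_same_sign:
  assumes "cf_nonzero c d" "0 \<le> z" "z < d"
  shows "cf_trunc c z N * c 0 > 0"
proof (rule ccontr)
  assume neg: "\<not> ?thesis"
  let ?f = "\<lambda>y. cf_trunc c y N * c 0"
  have cont: "continuous_on {0..z} ?f"
    by (intro continuous_intros continuous_on_subset[OF continuous_on_cf_trunc[OF assms(1)]])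
       (use assms(3) in auto)
  have c0: "c 0 \<noteq> 0" using cf_nonzero_coeff[OF assms(1)] assms by auto
  have "?f 0 \<ge> 0" by (simp add: cf_trunc_0)
  then obtain y where "0 \<le> y" "y \<le> z" "?f y = 0"
    using IVT2'[of ?f z 0 0] neg cont assms(2) by auto
  then show False using cf_nonzeroD[OF assms(1), of y N] assms(3) c0 by auto
qed

section \<open>Lower bounds uniform in the order of truncation\<close>

definition cf_bounded_below :: "(nat \<Rightarrow> real) \<Rightarrow> bool" where
  "cf_bounded_below c \<longleftrightarrow>
     (\<exists>m>0. \<exists>d>0. \<forall>z N. 0 \<le> z \<longrightarrow> z < d \<longrightarrow> m \<le> \<bar>cf_trunc c z N\<bar>)"

lemma cf_bounded_belowI:
  assumes "m > 0" "d > 0" "\<And>z N. 0 \<le> z \<Longrightarrow> z < d \<Longrightarrow> m \<le> \<bar>cf_trunc c z N\<bar>"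
  shows "cf_bounded_below c"
  using assms unfolding cf_bounded_below_def by blast

text \<open>The deviation from \<open>c 0\<close> is \<open>z\<close> divided by a truncation of the
  next tail, or zero for \<open>N = 0\<close>, so a lower bound \<open>m\<close> for that tail
  controls it.\<close>

lemma cf_trunc_near_0:
  assumes "cf_bounded_below (\<lambda>n. c (Suc n))"
  shows "\<exists>m>0. \<exists>d>0. \<forall>z N. 0 \<le> z \<longrightarrow> z < d \<longrightarrow> \<bar>cf_trunc c z N - c 0\<bar> \<le> z / m"
proof -
  obtain m d where m: "m > 0" "d > 0"
    and b: "\<And>z N. 0 \<le> z \<Longrightarrow> z < d \<Longrightarrow> m \<le> \<bar>cf_trunc (\<lambda>n. c (Suc n)) z N\<bar>"
    using assms unfolding cf_bounded_below_def by blast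
  have "\<bar>cf_trunc c z N - c 0\<bar> \<le> z / m" if "0 \<le> z" "z < d" for z N
  proof (cases N)
    case (Suc M)
    then show ?thesis using b[OF that, of M] that m by (auto simp: intro!: divide_left_mono mult_pos_pos)
  qed (use that m in auto)
  then show ?thesis using m by blast
qed

lemma cf_bounded_below_step:
  assumes "cf_bounded_below (\<lambda>n. c (Suc n))" "c 0 \<noteq> 0"
  shows "cf_bounded_below c"
proof -
  obtain m d where m: "m > 0" "d > 0"
    and b: "\<And>z N. 0 \<le> z \<Longrightarrow> z < d \<Longrightarrow> \<bar>cf_trunc c z N - c 0\<bar> \<le> z / m"
    using cf_trunc_near_0[OF assms(1)] by blast
  \<comment> \<open>Below \<open>m * |c 0| / 2\<close> the deviation \<open>z / m\<close> from
    \<open>c 0\<close> uses up at most half of \<open>|c 0|\<close>.\<close>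
  define e where "e = min d (m * \<bar>c 0\<bar> / 2)"
  have "\<bar>c 0\<bar> / 2 \<le> \<bar>cf_trunc c z N\<bar>" if "0 \<le> z" "z < e" for z N
  proof -
    have "z / m \<le> \<bar>c 0\<bar> / 2" using that m by (simp add: e_def field_simps)
    moreover have "\<bar>cf_trunc c z N - c 0\<bar> \<le> z / m" using that by (intro b) (auto simp: e_def)
    ultimately show ?thesis by linarith
  qed
  moreover have "e > 0" "\<bar>c 0\<bar> / 2 > 0" using m assms(2) by (auto simp: e_def)
  ultimately show ?thesis unfolding cf_bounded_below_def by blast
qed

lemma cf_bounded_below_shift:
  assumes "cf_bounded_below (\<lambda>n. c (n + k))" "\<And>k. c k \<noteq> 0"
  shows "cf_bounded_below c"
  using assms
proof (induction k arbitrary: c)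
  case (Suc k)
  have "cf_bounded_below (\<lambda>n. c (Suc n))"
    by (rule Suc.IH) (use Suc.prems in auto)
  then show ?case using Suc.prems(2) by (rule cf_bounded_below_step)
qed simp

text \<open>The next tail has the sign of \<open>c 1\<close>, hence of \<open>c 0\<close>, so the
  term added to \<open>c 0\<close> can only increase the modulus.\<close>

lemma cf_bounded_below_of_same_sign:
  assumes "cf_nonzero c d" "d > 0" "c 0 * c 1 > 0"
  shows "cf_bounded_below c"
proof -
  have "\<bar>c 0\<bar> \<le> \<bar>cf_trunc c z N\<bar>" if z: "0 \<le> z" "z < d" for z N
  proof (cases N)
    case (Suc M)
    have "cf_trunc (\<lambda>n. c (Suc n)) z M * c 1 > 0"
      using cf_trunc_same_sign[OF cf_nonzero_Suc[OF assms(1)] z] by simp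
    then have "c 0 > 0 \<and> cf_trunc (\<lambda>n. c (Suc n)) z M > 0 \<or> c 0 < 0 \<and> cf_trunc (\<lambda>n. c (Suc n)) z M < 0"
      using assms(3) by (auto simp: zero_less_mult_iff)
    then have "c 0 > 0 \<and> z / cf_trunc (\<lambda>n. c (Suc n)) z M \<ge> 0 
        \<or> c 0 < 0 \<and> z / cf_trunc (\<lambda>n. c (Suc n)) z M \<le> 0"
      using z by (auto simp: zero_le_divide_iff divide_le_0_iff)
    then show ?thesis using Suc by auto
  qed simp
  moreover have "\<bar>c 0\<bar> > 0" using assms by auto
  ultimately show ?thesis using assms(2) unfolding cf_bounded_below_def by blast
qed

text \<open>The added term has the sign opposite to \<open>c 0\<close>, yet the sum keeps the sign
  of \<open>c 0\<close>. Hence the moduli subtract without overshooting.\<close>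

lemma abs_cf_trunc_alternating:
  assumes "cf_nonzero c d" "c 0 * c 1 < 0" "0 \<le> z" "z < d"
  shows "\<bar>cf_trunc c z (Suc N)\<bar> = \<bar>c 0\<bar> - z / \<bar>cf_trunc (\<lambda>n. c (Suc n)) z N\<bar>"
proof -
  let ?t = "cf_trunc (\<lambda>n. c (Suc n)) z N"
  have "?t * c 1 > 0"
    using cf_trunc_same_sign[OF cf_nonzero_Suc[OF assms(1)] assms(3,4)] by simp
  moreover have "cf_trunc c z (Suc N) * c 0 > 0"
    by (rule cf_trunc_same_sign[OF assms(1,3,4)])
  ultimately have "(c 0 > 0 \<and> ?t < 0 \<and> cf_trunc c z (Suc N) > 0) \<or>
      (c 0 < 0 \<and> ?t > 0 \<and> cf_trunc c z (Suc N) < 0)"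
    using assms(2) by (auto simp: zero_less_mult_iff mult_less_0_iff)
  then show ?thesis by auto
qed

text \<open>By induction, a larger \<open>z\<close> is divided by a tail of smaller modulus, so more
  is subtracted from \<open>|c 0|\<close>.\<close>

lemma abs_cf_trunc_antimono:
  assumes "cf_nonzero c d" "\<And>k. c k * c (Suc k) < 0" "0 \<le> z" "z \<le> z'" "z' < d"
  shows "\<bar>cf_trunc c z' N\<bar> \<le> \<bar>cf_trunc c z N\<bar>"
  using assms(1,2)
proof (induction N arbitrary: c)
  case (Suc N)
  let ?t = "\<lambda>z. cf_trunc (\<lambda>n. c (Suc n)) z N"
  have nz: "cf_nonzero (\<lambda>n. c (Suc n)) d" by (rule cf_nonzero_Suc[OF Suc.prems(1)])
  have "\<bar>?t z'\<bar> \<le> \<bar>?t z\<bar>" by (rule Suc.IH[OF nz]) (use Suc.prems(2) in auto)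
  moreover have "\<bar>?t z'\<bar> > 0" using cf_nonzeroD[OF nz] assms(3-5) by auto
  ultimately have "z / \<bar>?t z\<bar> \<le> z' / \<bar>?t z'\<bar>" using assms(3-5) by (intro frac_le) auto
  then show ?case
    using abs_cf_trunc_alternating[OF Suc.prems(1), of z N]
      abs_cf_trunc_alternating[OF Suc.prems(1), of z' N] Suc.prems(2)[of 0] assms(3-5) by auto
qed simp

lemma cf_bounded_below_of_alternating:
  assumes "cf_nonzero c d" "d > 0" "\<And>k. c k * c (Suc k) < 0"
  shows "cf_bounded_below c"
proof -
  have c0: "\<bar>c 0\<bar> > 0" using assms(3)[of 0] by auto
  have nz: "cf_nonzero (\<lambda>n. c (Suc n)) d" by (rule cf_nonzero_Suc[OF assms(1)])
  \<comment> \<open>At \<open>z = d / 2\<close> the modulus \<open>|c 0| - z / |?t z|\<close> is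
    nonnegative, which forces \<open>|?t (d/2)|\<close> to be at least \<open>m\<close> for every
    \<open>N\<close>; antitonicity carries this to smaller \<open>z\<close>.\<close>
  define m where "m = d / 2 / \<bar>c 0\<bar>"
  have "m \<le> \<bar>cf_trunc (\<lambda>n. c (Suc n)) z N\<bar>" if "0 \<le> z" "z < d / 2" for z N
  proof -
    let ?t = "\<lambda>z. cf_trunc (\<lambda>n. c (Suc n)) z N"
    have "\<bar>?t (d/2)\<bar> > 0" using cf_nonzeroD[OF nz] assms(2) by auto
    moreover have "\<bar>c 0\<bar> - (d/2) / \<bar>?t (d/2)\<bar> \<ge> 0"
      using abs_cf_trunc_alternating[OF assms(1), of "d/2" N] assms(3)[of 0] assms(2)
        abs_ge_zero[of "cf_trunc c (d/2) (Suc N)"] by (simp del: abs_ge_zero cf_trunc.simps)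
    ultimately have "d / 2 / \<bar>c 0\<bar> \<le> \<bar>?t (d/2)\<bar>" using c0 by (simp add: field_simps)
    also have "\<dots> \<le> \<bar>?t z\<bar>"
      by (rule abs_cf_trunc_antimono[OF nz]) (use that assms(2,3) in auto)
    finally show ?thesis by (simp only: m_def)
  qed
  moreover have "m > 0" "d / 2 > 0" using c0 assms(2) by (auto simp: m_def)
  ultimately have "cf_bounded_below (\<lambda>n. c (Suc n))"
    by (intro cf_bounded_belowI)
  then show ?thesis by (rule cf_bounded_below_step) (use c0 in auto)
qed

text \<open>
  Two consecutive coefficients of equal sign give a lower bound at once, which is transported back
  to the start. Otherwise the signs alternate and the tails decrease in modulus as \<open>z\<close> grows.
\<close>

lemma cf_bounded_below_of_nonzero:
  assumes "cf_nonzero c d" "d > 0"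
  shows "cf_bounded_below c"
proof (cases "\<exists>k. c k * c (Suc k) > 0")
  case True
  then obtain k where k: "c k * c (Suc k) > 0" by blast
  have "cf_bounded_below (\<lambda>n. c (n + k))"
    by (rule cf_bounded_below_of_same_sign[OF cf_nonzero_shift[OF assms(1)] assms(2)]) (use k in simp)
  then show ?thesis using cf_nonzero_coeff[OF assms] by (rule cf_bounded_below_shift)
next
  case False
  moreover have "c k * c (Suc k) \<noteq> 0" for k using cf_nonzero_coeff[OF assms] by simp
  ultimately have "c k * c (Suc k) < 0" for k by (meson linorder_neqE_linordered_idom)
  then show ?thesis using assms by (intro cf_bounded_below_of_alternating)
qed

section \<open>Tails of the infinite fraction\<close>

text \<open>The tails are recovered from the value \<open>v\<close> by solving for them
  algebraically rather than as limits, so that differentiability in \<open>x\<close> can pass from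
  one tail to the next.\<close>

fun cf_tail :: "(nat \<Rightarrow> real) \<Rightarrow> real \<Rightarrow> real \<Rightarrow> nat \<Rightarrow> real" where
  "cf_tail c z v 0 = v"
| "cf_tail c z v (Suc n) = z / (cf_tail c z v n - c n)"

lemma cf_tail_convergence:
  assumes d: "d > 0" and nz: "cf_nonzero (\<lambda>n. c (Suc n)) d"
    and lim: "\<And>z. 0 < z \<Longrightarrow> z < d \<Longrightarrow> (\<lambda>N. cf_trunc c z N) \<longlonglongrightarrow> v z"
  shows "\<exists>e>0. \<forall>z. 0 < z \<longrightarrow> z < e \<longrightarrow>
           (\<lambda>N. cf_trunc (\<lambda>k. c (k + n)) z N) \<longlonglongrightarrow> cf_tail c z (v z) n"
proof (induction n)
  case 0
  then show ?case using d lim by auto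
next
  case (Suc n)
  then obtain e where e: "e > 0"
    and IH: "\<And>z. 0 < z \<Longrightarrow> z < e \<Longrightarrow>
      (\<lambda>N. cf_trunc (\<lambda>k. c (k + n)) z N) \<longlonglongrightarrow> cf_tail c z (v z) n" by blast
  let ?t = "\<lambda>z N. cf_trunc (\<lambda>k. c (k + Suc n)) z N"
  have nzn: "cf_nonzero (\<lambda>k. c (k + Suc n)) d"
    using cf_nonzero_shift[OF nz, of n] by simp
  have "cf_bounded_below (\<lambda>k. c (Suc k + Suc n))"
    using cf_bounded_below_of_nonzero[OF cf_nonzero_Suc[OF nzn] d] by simp
  then obtain m d' where m: "m > 0" "d' > 0"
    and b: "\<And>z N. 0 \<le> z \<Longrightarrow> z < d' \<Longrightarrow> \<bar>?t z N - c (Suc n)\<bar> \<le> z / m"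
    using cf_trunc_near_0[of "\<lambda>k. c (k + Suc n)"] by auto
  have "(\<lambda>N. ?t z N) \<longlonglongrightarrow> cf_tail c z (v z) (Suc n)"
    if z: "0 < z" "z < min d (min e d')" for z
  proof -
    have t0: "?t z N \<noteq> 0" for N using cf_nonzeroD[OF nzn] z by auto
    \<comment> \<open>An upper bound \<open>M\<close> for the next tail keeps
      \<open>z / ?t z N\<close> at distance \<open>z / M\<close> from zero. So its limit is nonzero,
      and dividing \<open>z\<close> by it recovers the limit of \<open>?t z N\<close>.\<close>
    define M where "M = \<bar>c (Suc n)\<bar> + z / m"
    have tM: "\<bar>?t z N\<bar> \<le> M" for N using b[of z N] z by (auto simp: M_def)
    have M0: "M > 0" using tM[of 0] t0[of 0] by linarith
    have eq: "cf_trunc (\<lambda>k. c (k + n)) z (Suc N) - c n = z / ?t z N" for N by simp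
    have L: "(\<lambda>N. z / ?t z N) \<longlonglongrightarrow> cf_tail c z (v z) n - c n"
      unfolding eq[symmetric] using IH[of z] z by (intro tendsto_diff tendsto_const LIMSEQ_Suc) auto
    have "z / M \<le> \<bar>z / ?t z N\<bar>" for N
      using tM[of N] t0[of N] z M0 by (auto intro!: divide_left_mono mult_pos_pos)
    then have "z / M \<le> \<bar>cf_tail c z (v z) n - c n\<bar>"
      by (intro tendsto_lowerbound[OF tendsto_rabs[OF L]]) auto
    moreover have "z / M > 0" using z M0 by simp
    ultimately have "cf_tail c z (v z) n - c n \<noteq> 0" by auto
    from tendsto_divide[OF tendsto_const[of z] L this] show ?thesis using z by simp
  qed
  then show ?case using d e m by (intro exI[of _ "min d (min e d')"]) auto
qed

text \<open>The bound \<open>z / m\<close> on the deviation from \<open>c n\<close> does not depend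
  on \<open>N\<close>, so it survives the limit in \<open>N\<close> and then tends to 0 with
  \<open>z\<close>.\<close>

lemma cf_tail_tendsto_coeff:
  assumes d: "d > 0" and nz: "cf_nonzero (\<lambda>n. c (Suc n)) d"
    and lim: "\<And>z. 0 < z \<Longrightarrow> z < d \<Longrightarrow> (\<lambda>N. cf_trunc c z N) \<longlonglongrightarrow> v z"
  shows "((\<lambda>z. cf_tail c z (v z) n) \<longlongrightarrow> c n) (at_right 0)"
proof -
  obtain e where e: "e > 0"
    and conv: "\<And>z. 0 < z \<Longrightarrow> z < e \<Longrightarrow>
      (\<lambda>N. cf_trunc (\<lambda>k. c (k + n)) z N) \<longlonglongrightarrow> cf_tail c z (v z) n"
    using cf_tail_convergence[OF assms] by blast
  have "cf_bounded_below (\<lambda>k. c (Suc k + n))"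
    using cf_bounded_below_of_nonzero[OF cf_nonzero_shift[OF nz] d] by simp
  then obtain m d' where m: "m > 0" "d' > 0"
    and b: "\<And>z N. 0 \<le> z \<Longrightarrow> z < d' \<Longrightarrow> \<bar>cf_trunc (\<lambda>k. c (k + n)) z N - c n\<bar> \<le> z / m"
    using cf_trunc_near_0[of "\<lambda>k. c (k + n)"] by auto
  have bd: "\<bar>cf_tail c z (v z) n - c n\<bar> \<le> z / m" if "0 < z" "z < min e d'" for z
    by (rule tendsto_upperbound[OF tendsto_rabs[OF tendsto_diff[OF conv tendsto_const]]])
       (use that b in auto)
  have "((\<lambda>z. z / m) \<longlongrightarrow> 0) (at_right 0)"
    by (auto intro!: tendsto_eq_intros simp: m less_imp_neq[OF m(1), symmetric])
  then have "((\<lambda>z. cf_tail c z (v z) n - c n) \<longlongrightarrow> 0) (at_right 0)"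
    by (rule Lim_null_comparison[rotated])
       (use bd e m in \<open>auto simp: eventually_at_right_field intro!: exI[of _ "min e d'"]\<close>)
  then show ?thesis by (simp add: LIM_zero_iff)
qed

section \<open>Limits of Riccati equations\<close>

lemma integral_has_real_derivative_interior:
  fixes f :: "real \<Rightarrow> real"
  assumes "continuous_on {a..b} f" "a < x" "x < b"
  shows "((\<lambda>y. integral {a..y} f) has_real_derivative f x) (at x)"
proof -
  have "((\<lambda>y. integral {a..y} f) has_real_derivative f x) (at x within {a..b})"
    using assms by (intro integral_has_real_derivative) auto
  moreover have "at x within {a..b} = at x" using assms by (intro at_within_interior) auto
  ultimately show ?thesis by simp
qed

lemma antiderivative_interior:
  fixes f :: "real \<Rightarrow> real"
  assumes "continuous_on {a..b} f"
  obtains F where "\<And>x. a < x \<Longrightarrow> x < b \<Longrightarrow> (F has_real_derivative f x) (at x)"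
  using integral_has_real_derivative_interior[OF assms] by blast

lemma continuous_on_Icc_bounded:
  fixes f :: "real \<Rightarrow> real"
  assumes "continuous_on {a..b} f"
  obtains M where "\<And>x. x \<in> {a..b} \<Longrightarrow> \<bar>f x\<bar> \<le> M"
proof -
  have "bounded (f ` {a..b})"
    by (rule compact_imp_bounded[OF compact_continuous_image[OF assms compact_Icc]])
  then obtain M where "\<forall>y\<in>f ` {a..b}. norm y \<le> M" by (auto simp only: bounded_iff)
  then show ?thesis using that by force
qed

lemma riccati_solutionD:
  assumes "riccati_solution S w g u" "x \<in> S"
  shows "(u has_real_derivative (g x - (u x)\<^sup>2 - 2 * w x * u x)) (at x)"
proof -
  have "(u has_real_derivative deriv u x) (at x)"
    using assms unfolding riccati_solution_def
    by (simp add: DERIV_deriv_iff_real_differentiable)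
  moreover have "deriv u x = g x - (u x)\<^sup>2 - 2 * w x * u x"
    using assms unfolding riccati_solution_def by (auto simp: algebra_simps)
  ultimately show ?thesis by simp
qed

lemma riccati_solutionI:
  assumes "\<And>x. x \<in> S \<Longrightarrow> (u has_real_derivative (g x - (u x)\<^sup>2 - 2 * w x * u x)) (at x)"
  shows "riccati_solution S w g u"
  unfolding riccati_solution_def
proof (intro ballI conjI)
  fix x assume "x \<in> S"
  from assms[OF this] show "u differentiable (at x)"
    "deriv u x + (u x)\<^sup>2 + 2 * w x * u x = g x"
    by (auto simp: real_differentiable_def DERIV_imp_deriv)
qed

text \<open>Since \<open>w\<close> need not be integrable, \<open>p\<close> is not built by
  integrating it. Dividing the equation by \<open>u\<close> gives
  \<open>2 w = g / u - u - u' / u\<close>; with \<open>G\<close> an antiderivative of the continuous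
  part \<open>g / u - u\<close>, this leads to \<open>p = exp G / |u|\<close>.\<close>

lemma riccati_integrating_factor:
  assumes r: "r > 0" and sol: "riccati_solution (ball x0 r) w g u"
    and g: "continuous_on (ball x0 r) g" and u0: "u x0 \<noteq> 0"
  obtains s p where "0 < s" "s \<le> r"
    "\<And>x. x \<in> ball x0 s \<Longrightarrow> p x > 0"
    "\<And>x. x \<in> ball x0 s \<Longrightarrow> (p has_real_derivative 2 * w x * p x) (at x)"
proof -
  define \<sigma> where "\<sigma> = sgn (u x0)"
  note D = riccati_solutionD[OF sol]
  have "isCont u x0" using D[of x0] r by (auto intro: DERIV_isCont)
  then have "isCont (\<lambda>x. \<sigma> * u x) x0" by (intro continuous_intros)
  moreover have "\<sigma> * u x0 > 0" using u0 by (simp add: \<sigma>_def abs_sgn[symmetric] mult.commute)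
  ultimately have "\<forall>\<^sub>F x in at x0. \<sigma> * u x > 0"
    using order_tendstoD(1) by (auto simp: isCont_def)
  then obtain d where d: "d > 0" "\<And>x. x \<noteq> x0 \<Longrightarrow> dist x x0 < d \<Longrightarrow> \<sigma> * u x > 0"
    by (auto simp: eventually_at)
  define s where "s = min d r / 2"
  have s: "s > 0" "s < d" "s < r" using d r by (auto simp: s_def)
  have pos: "\<sigma> * u x > 0" if "x \<in> cball x0 s" for x
    using d(2)[of x] \<open>\<sigma> * u x0 > 0\<close> that s by (cases "x = x0") (auto simp: dist_commute)
  have sub: "cball x0 s \<subseteq> ball x0 r" using s by auto
  have "continuous_on (cball x0 s) u"
    using D sub by (blast intro: continuous_at_imp_continuous_on DERIV_isCont)
  then have "continuous_on (cball x0 s) (\<lambda>x. g x / u x - u x)"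
    using pos by (intro continuous_intros continuous_on_subset[OF g sub]) force+
  then have "continuous_on {x0 - s..x0 + s} (\<lambda>x. g x / u x - u x)"
    by (simp add: cball_eq_atLeastAtMost)
  then obtain G where G: "\<And>x. x0 - s < x \<Longrightarrow> x < x0 + s \<Longrightarrow> (G has_real_derivative (g x / u x - u x)) (at x)"
    by (rule antiderivative_interior) blast
  define p where "p = (\<lambda>x. exp (G x) / (\<sigma> * u x))"
  show ?thesis
  proof
    show "0 < s" "s \<le> r" using s by auto
    fix x assume x: "x \<in> ball x0 s"
    then have x': "x \<in> cball x0 s" "x \<in> ball x0 r" "x0 - s < x" "x < x0 + s"
      using s by (auto simp: dist_real_def)
    show "p x > 0" using pos[OF x'(1)] by (simp add: p_def)
    have nz: "u x \<noteq> 0" "\<sigma> \<noteq> 0" using pos[OF x'(1)] by auto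
    show "(p has_real_derivative 2 * w x * p x) (at x)"
      unfolding p_def
      by (rule derivative_eq_intros G[OF x'(3,4)] D[OF x'(2)] refl)+
         (use nz in \<open>auto simp: divide_simps power2_eq_square, simp add: algebra_simps\<close>)
  qed
qed

text \<open>
  The bound needs no uniformity of the limit: as \<open>V l\<close> grows at most at rate \<open>l * h\<close>, its value at \<open>c\<close>
  bounds it from above and its value at \<open>d\<close> bounds it from below.
\<close>

lemma inhomogeneous_riccati_limit:
  fixes V :: "real \<Rightarrow> real \<Rightarrow> real" and V0 h k :: "real \<Rightarrow> real"
  assumes "c < d" "\<delta> > 0"
    and h: "continuous_on {c..d} h" "\<And>x. x \<in> {c..d} \<Longrightarrow> h x \<ge> 0"
    and k: "continuous_on {c..d} k" "\<And>x. x \<in> {c..d} \<Longrightarrow> k x \<ge> 0"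
    and V: "\<And>l x. 0 < l \<Longrightarrow> l < \<delta> \<Longrightarrow> x \<in> {c..d} \<Longrightarrow>
              (V l has_real_derivative (l * h x - k x * (V l x)\<^sup>2)) (at x)"
    and lim: "\<And>x. x \<in> {c..d} \<Longrightarrow> ((\<lambda>l. V l x) \<longlongrightarrow> V0 x) (at_right 0)"
  shows "\<exists>B e. e > 0 \<and> (\<forall>l x. 0 < l \<longrightarrow> l < e \<longrightarrow> x \<in> {c..d} \<longrightarrow> \<bar>V l x\<bar> \<le> B)"
    and "\<And>x. c < x \<Longrightarrow> x < d \<Longrightarrow> (V0 has_real_derivative (- k x * (V0 x)\<^sup>2)) (at x)"
proof -
  obtain H where H: "\<And>x. x \<in> {c..d} \<Longrightarrow> h x \<le> H"
    using continuous_on_Icc_bounded[OF h(1)] by (metis abs_le_D1)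
  obtain K where K: "\<And>x. x \<in> {c..d} \<Longrightarrow> k x \<le> K"
    using continuous_on_Icc_bounded[OF k(1)] by (metis abs_le_D1)
  have H0: "H \<ge> 0" using H[of c] h(2)[of c] \<open>c < d\<close> by auto
  have "\<forall>\<^sub>F l in at_right 0. V l c < V0 c + 1"
    by (rule order_tendstoD(2)[OF lim]) (use \<open>c < d\<close> in auto)
  then obtain e1 where e1: "e1 > 0" "\<And>l. 0 < l \<Longrightarrow> l < e1 \<Longrightarrow> V l c < V0 c + 1"
    by (auto simp: eventually_at_right_field)
  have "\<forall>\<^sub>F l in at_right 0. V l d > V0 d - 1"
    by (rule order_tendstoD(1)[OF lim]) (use \<open>c < d\<close> in auto)
  then obtain e2 where e2: "e2 > 0" "\<And>l. 0 < l \<Longrightarrow> l < e2 \<Longrightarrow> V l d > V0 d - 1"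
    by (auto simp: eventually_at_right_field)
  \<comment> \<open>The cap 1 on \<open>l\<close> yields \<open>l * h \<le> H\<close>, so that
    \<open>V l y - H * y\<close> is nonincreasing in \<open>y\<close>.\<close>
  define e where "e = min (min e1 e2) (min \<delta> 1)"
  define B where "B = \<bar>V0 c\<bar> + \<bar>V0 d\<bar> + 1 + H * (d - c)"
  have e: "e > 0" using e1 e2 \<open>\<delta> > 0\<close> by (auto simp: e_def)
  have bound: "\<bar>V l x\<bar> \<le> B" if l: "0 < l" "l < e" and x: "x \<in> {c..d}" for l x
  proof -
    have le: "l * h y - k y * (V l y)\<^sup>2 - H \<le> 0" if "y \<in> {c..d}" for y
    proof -
      have "l * h y \<le> 1 * H" using l H[OF that] h(2)[OF that] by (intro mult_mono) (auto simp: e_def)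
      moreover have "k y * (V l y)\<^sup>2 \<ge> 0" using k(2)[OF that] by simp
      ultimately show ?thesis by linarith
    qed
    have mono: "V l y - H * y \<ge> V l z - H * z" if "c \<le> y" "y \<le> z" "z \<le> d" for y z
      using that(2)
    proof (rule DERIV_nonpos_imp_nonincreasing)
      fix t assume t: "y \<le> t" "t \<le> z"
      then have t: "t \<in> {c..d}" using that by auto
      have "((\<lambda>x. V l x - H * x) has_real_derivative (l * h t - k t * (V l t)\<^sup>2 - H)) (at t)"
        using l by (auto intro!: derivative_eq_intros V t simp: e_def)
      then show "\<exists>y. ((\<lambda>x. V l x - H * x) has_real_derivative y) (at t) \<and> y \<le> 0"
        using le[OF t] by blast
    qed
    have "V l x \<le> V l c + H * (x - c)" using mono[of c x] x by (auto simp: algebra_simps)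
    moreover have "H * (x - c) \<le> H * (d - c)" using x H0 by (intro mult_left_mono) auto
    moreover have "V l x \<ge> V l d - H * (d - x)" using mono[of x d] x by (auto simp: algebra_simps)
    moreover have "H * (d - x) \<le> H * (d - c)" using x H0 by (intro mult_left_mono) auto
    ultimately show ?thesis using e1(2)[of l] e2(2)[of l] l by (auto simp: B_def e_def)
  qed
  then show "\<exists>B e. e > 0 \<and> (\<forall>l x. 0 < l \<longrightarrow> l < e \<longrightarrow> x \<in> {c..d} \<longrightarrow> \<bar>V l x\<bar> \<le> B)"
    using e by blast
  \<comment> \<open>Dominated convergence is stated for sequences, so \<open>l\<close> tends to 0
    along one. The summand 2 keeps \<open>l j < e\<close> strict also at
    \<open>j = 0\<close>.\<close>
  define l where "l = (\<lambda>j::nat. e / (real j + 2))"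
  have l: "0 < l j" "l j < e" "l j \<le> 1" for j
  proof -
    show "0 < l j" using e by (simp add: l_def)
    have "e / (real j + 2) < e / 1" using e by (intro divide_strict_left_mono) auto
    then show "l j < e" by (simp add: l_def)
    then show "l j \<le> 1" by (simp add: e_def)
  qed
  have "l \<longlonglongrightarrow> 0" unfolding l_def by real_asymp
  then have lr: "filterlim l (at_right 0) sequentially"
    using l by (auto simp: filterlim_at less_imp_neq[OF l(1), symmetric])
  have limj: "(\<lambda>j. V (l j) x) \<longlonglongrightarrow> V0 x" if "x \<in> {c..d}" for x
    using filterlim_compose[OF lim[OF that] lr] .
  \<comment> \<open>\<open>V0\<close> is so far only a pointwise limit. Dominated convergence
    supplies both the integrability of its right-hand side and the integrated equation.\<close>
  have int: "V0 x = V0 c + integral {c..x} (\<lambda>y. - k y * (V0 y)\<^sup>2)"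
    and integrable: "(\<lambda>y. - k y * (V0 y)\<^sup>2) integrable_on {c..x}" if x: "x \<in> {c..d}" for x
  proof -
    let ?f = "\<lambda>j y. l j * h y - k y * (V (l j) y)\<^sup>2"
    have sub: "{c..x} \<subseteq> {c..d}" using x by auto
    have ftc: "(?f j has_integral (V (l j) x - V (l j) c)) {c..x}" for j
    proof (rule fundamental_theorem_of_calculus)
      show "c \<le> x" using x by simp
      fix y assume "y \<in> {c..x}"
      then have "(V (l j) has_real_derivative ?f j y) (at y)"
        using V[of "l j" y] l[of j] x by (simp add: e_def)
      then show "(V (l j) has_vector_derivative ?f j y) (at y within {c..x})"
        unfolding has_real_derivative_iff_has_vector_derivative by (rule has_vector_derivative_at_within)
    qed
    have *: "norm (?f j y) \<le> H + K * B\<^sup>2" if "y \<in> {c..x}" for j y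
    proof -
      have y: "y \<in> {c..d}" using that sub by auto
      have "0 \<le> l j * h y" "l j * h y \<le> 1 * H"
        using l[of j] h(2)[OF y] H[OF y] by (simp, intro mult_mono) auto
      moreover have "(V (l j) y)\<^sup>2 \<le> B\<^sup>2"
        using bound[OF l(1,2) y, of j] by (metis abs_ge_zero power2_abs power_mono)
      then have "k y * (V (l j) y)\<^sup>2 \<le> K * B\<^sup>2" "k y * (V (l j) y)\<^sup>2 \<ge> 0"
        using k(2)[OF y] K[OF y] by (auto intro!: mult_mono)
      ultimately show ?thesis by (simp add: abs_le_iff)
    qed
    have **: "(\<lambda>j. ?f j y) \<longlonglongrightarrow> - k y * (V0 y)\<^sup>2" if "y \<in> {c..x}" for y
      using that sub by (auto intro!: tendsto_eq_intros limj \<open>l \<longlonglongrightarrow> 0\<close>)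
    note dc = dominated_convergence[of ?f "{c..x}" "\<lambda>_. H + K * B\<^sup>2" "\<lambda>y. - k y * (V0 y)\<^sup>2",
        OF has_integral_integrable[OF ftc] _ * **]
    show "(\<lambda>y. - k y * (V0 y)\<^sup>2) integrable_on {c..x}" using dc(1) by auto
    have "(\<lambda>j. integral {c..x} (?f j)) \<longlonglongrightarrow> V0 x - V0 c"
      unfolding integral_unique[OF ftc] using x by (intro tendsto_diff limj) auto
    with dc(2) show "V0 x = V0 c + integral {c..x} (\<lambda>y. - k y * (V0 y)\<^sup>2)"
      using LIMSEQ_unique by fastforce
  qed
  \<comment> \<open>Bootstrapping: an indefinite integral is continuous, hence \<open>V0\<close> is,
    hence the integrand \<open>g\<close> is, and then the integral is differentiable.\<close>
  define g where "g = (\<lambda>y. - k y * (V0 y)\<^sup>2)"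
  have V0_int: "V0 c + integral {c..x} g = V0 x" if "x \<in> {c..d}" for x
    unfolding g_def by (rule int[OF that, symmetric])
  have "g integrable_on {c..d}" using integrable[of d] \<open>c < d\<close> by (simp add: g_def)
  then have "continuous_on {c..d} (\<lambda>x. V0 c + integral {c..x} g)"
    by (intro continuous_on_add continuous_on_const indefinite_integral_continuous_1)
  then have V0c: "continuous_on {c..d} V0"
    by (rule continuous_on_eq) (rule V0_int)
  then have "continuous_on {c..d} g"
    unfolding g_def by (intro continuous_on_mult continuous_on_minus continuous_on_power k(1))
  note F = integral_has_real_derivative_interior[OF this]
  fix x assume x: "c < x" "x < d"
  have "((\<lambda>x. V0 c + integral {c..x} g) has_real_derivative g x) (at x)"
    using DERIV_add[OF DERIV_const F[OF x]] by simp
  then have "(V0 has_real_derivative g x) (at x)"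
    by (rule has_field_derivative_transform_within_open[of _ _ _ "{c<..<d}"])
       (use x V0_int in auto)
  then show "(V0 has_real_derivative (- k x * (V0 x)\<^sup>2)) (at x)" by (simp only: g_def)
qed

text \<open>The quotient \<open>q = (V l - V0) / l\<close> solves the linear equation
  \<open>q' = h - k (V l + V0) q\<close>, whose coefficients are bounded uniformly in
  \<open>l\<close>. As \<open>q\<close> is near \<open>s\<close> at \<open>x0\<close>, it needs a
  distance independent of \<open>l\<close> to reach zero.\<close>

lemma inhomogeneous_riccati_separation:
  fixes V :: "real \<Rightarrow> real \<Rightarrow> real" and V0 h k :: "real \<Rightarrow> real"
  assumes x0: "c < x0" "x0 < d" and "\<delta> > 0"
    and h: "continuous_on {c..d} h"
    and k: "continuous_on {c..d} k"
    and V: "\<And>l x. 0 < l \<Longrightarrow> l < \<delta> \<Longrightarrow> x \<in> {c..d} \<Longrightarrow>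
              (V l has_real_derivative (l * h x - k x * (V l x)\<^sup>2)) (at x)"
    and V0: "\<And>x. x \<in> {c..d} \<Longrightarrow> (V0 has_real_derivative (- k x * (V0 x)\<^sup>2)) (at x)"
    and bound: "\<And>l x. 0 < l \<Longrightarrow> l < \<delta> \<Longrightarrow> x \<in> {c..d} \<Longrightarrow> \<bar>V l x\<bar> \<le> B"
    and lim: "((\<lambda>l. (V l x0 - V0 x0) / l) \<longlongrightarrow> s) (at_right 0)" "s \<noteq> 0"
  shows "\<exists>r>0. \<exists>e>0. \<forall>l x. 0 < l \<longrightarrow> l < e \<longrightarrow> x \<in> ball x0 r \<longrightarrow> V l x \<noteq> V0 x"
proof -
  have V0c: "continuous_on {c..d} V0"
    by (intro continuous_at_imp_continuous_on ballI, rule DERIV_isCont, rule V0)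
  obtain H where H: "\<And>x. x \<in> {c..d} \<Longrightarrow> \<bar>h x\<bar> \<le> H"
    using continuous_on_Icc_bounded[OF h] by blast
  obtain K where K: "\<And>x. x \<in> {c..d} \<Longrightarrow> \<bar>k x\<bar> \<le> K"
    using continuous_on_Icc_bounded[OF k] by blast
  obtain B0 where B0: "\<And>x. x \<in> {c..d} \<Longrightarrow> \<bar>V0 x\<bar> \<le> B0"
    using continuous_on_Icc_bounded[OF V0c] by blast
  have "((\<lambda>l. \<bar>(V l x0 - V0 x0) / l\<bar>) \<longlongrightarrow> \<bar>s\<bar>) (at_right 0)" by (rule tendsto_rabs[OF lim(1)])
  then have "\<forall>\<^sub>F l in at_right 0. \<bar>(V l x0 - V0 x0) / l\<bar> > \<bar>s\<bar> / 2"
    by (rule order_tendstoD(1)) (use lim(2) in auto)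
  then obtain e where e: "e > 0" "\<And>l. 0 < l \<Longrightarrow> l < e \<Longrightarrow> \<bar>(V l x0 - V0 x0) / l\<bar> > \<bar>s\<bar> / 2"
    by (auto simp: eventually_at_right_field)
  \<comment> \<open>\<open>C\<close> bounds \<open>k (V l + V0)\<close>, the derivative of the
    exponent \<open>G\<close> below. Thus \<open>H * exp (C * r)\<close> bounds the derivative of
    \<open>T\<close>, and \<open>r\<close> is chosen so that \<open>T\<close> varies by less than
    \<open>|s| / 2\<close> over the ball.\<close>
  define C where "C = K * (B + B0)"
  have "((\<lambda>r. H * exp (C * r) * r) \<longlongrightarrow> 0) (at_right 0)"
    by (auto intro!: tendsto_eq_intros)
  then have "\<forall>\<^sub>F r in at_right 0. H * exp (C * r) * r < \<bar>s\<bar> / 2"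
    by (rule order_tendstoD(2)) (use lim(2) in auto)
  then obtain r1 where r1: "r1 > 0" "\<And>r. 0 < r \<Longrightarrow> r < r1 \<Longrightarrow> H * exp (C * r) * r < \<bar>s\<bar> / 2"
    by (auto simp: eventually_at_right_field)
  define r where "r = min r1 (min (x0 - c) (d - x0)) / 2"
  have r: "r > 0" "r < r1" "c < x0 - r" "x0 + r < d"
    using r1 x0 unfolding r_def min_def by (auto simp: field_simps)
  have sub: "x \<in> {c..d}" "c < x" "x < d" if "x \<in> ball x0 r" for x
    using that r by (auto simp: dist_real_def)
  have "V l y \<noteq> V0 y" if l: "0 < l" "l < min e \<delta>" and y: "y \<in> ball x0 r" for l y
  proof
    assume eq: "V l y = V0 y"
    have "continuous_on {c..d} (V l)"
      by (intro continuous_at_imp_continuous_on ballI, rule DERIV_isCont, rule V) (use l in auto)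
    then have "continuous_on {c..d} (\<lambda>x. k x * (V l x + V0 x))"
      by (intro continuous_intros k V0c)
    then obtain F where F: "\<And>x. c < x \<Longrightarrow> x < d \<Longrightarrow> (F has_real_derivative (k x * (V l x + V0 x))) (at x)"
      by (rule antiderivative_interior) blast
    \<comment> \<open>Normalised by \<open>G x0 = 0\<close>, so that \<open>T x0\<close> is the
      difference quotient itself.\<close>
    define G where "G = (\<lambda>x. F x - F x0)"
    define T where "T = (\<lambda>x. (V l x - V0 x) / l * exp (G x))"
    have G: "(G has_real_derivative (k x * (V l x + V0 x))) (at x)" if "x \<in> ball x0 r" for x
      unfolding G_def using sub[OF that] by (auto intro!: derivative_eq_intros F)
    have C: "\<bar>k x * (V l x + V0 x)\<bar> \<le> C" if "x \<in> ball x0 r" for x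
    proof -
      note s = sub(1)[OF that]
      have "\<bar>V l x + V0 x\<bar> \<le> B + B0" using bound[of l x] B0[OF s] l s by auto
      then show ?thesis unfolding C_def abs_mult using K[OF s] by (intro mult_mono) auto
    qed
    have T: "(T has_real_derivative (h x * exp (G x))) (at x)" if "x \<in> ball x0 r" for x
    proof -
      have "(V l has_real_derivative (l * h x - k x * (V l x)\<^sup>2)) (at x)"
        using V[of l x] l sub(1)[OF that] by simp
      note D = this V0[OF sub(1)[OF that]] G[OF that]
      have "l \<noteq> 0" using l by simp
      show ?thesis
        unfolding T_def
        by (rule derivative_eq_intros D \<open>l \<noteq> 0\<close> refl)+ (use l in \<open>auto simp: field_simps power2_eq_square\<close>)
    qed
    have x0r: "x0 \<in> ball x0 r" using r by simp
    have Gb: "\<bar>G x\<bar> \<le> C * r" if "x \<in> ball x0 r" for x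
    proof -
      have "\<bar>G x - G x0\<bar> \<le> C * \<bar>x - x0\<bar>"
        using field_differentiable_bound[of "ball x0 r" G "\<lambda>x. k x * (V l x + V0 x)" C x x0]
          G C that x0r by (auto intro: has_field_derivative_at_within)
      also have "\<dots> \<le> C * r"
        using that C[OF x0r] by (intro mult_left_mono) (auto simp: dist_real_def)
      finally show ?thesis by (simp add: G_def)
    qed
    have dT: "\<bar>h x * exp (G x)\<bar> \<le> H * exp (C * r)" if "x \<in> ball x0 r" for x
      unfolding abs_mult using H[OF sub(1)[OF that]] Gb[OF that] by (intro mult_mono) auto
    \<comment> \<open>At a coincidence point \<open>T y = 0\<close>, so the small variation of
      \<open>T\<close> contradicts \<open>|T x0| > |s| / 2\<close>.\<close>
    have "\<bar>T x0 - T y\<bar> \<le> H * exp (C * r) * \<bar>x0 - y\<bar>"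
      using field_differentiable_bound[of "ball x0 r" T "\<lambda>x. h x * exp (G x)" "H * exp (C * r)" x0 y]
        T dT y x0r by (auto intro: has_field_derivative_at_within)
    also have "\<dots> \<le> H * exp (C * r) * r"
      using y dT[OF x0r] by (intro mult_left_mono) (auto simp: dist_real_def)
    also have "\<dots> < \<bar>s\<bar> / 2" using r r1 by auto
    finally have "\<bar>T x0\<bar> < \<bar>s\<bar> / 2" by (simp add: T_def eq)
    then show False using e(2)[of l] l by (simp add: T_def G_def)
  qed
  moreover have "min e \<delta> > 0" using e \<open>\<delta> > 0\<close> by simp
  ultimately show ?thesis using r(1) by blast
qed

section \<open>Passing from one tail to the next\<close>

text \<open>In the quotient rule for \<open>n / D\<close>, the quadratic term \<open>D * D\<close>
  in the derivative of \<open>D\<close> returns the inhomogeneity \<open>n\<close>, and the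
  logarithmic derivative \<open>- A\<close> of \<open>n\<close> produces the summand
  \<open>a' / (2 * a x)\<close> of the new coefficient.\<close>

lemma riccati_tail_derivative:
  fixes U u a w :: "real \<Rightarrow> real"
  assumes U: "(U has_real_derivative (2 * l / a x - (U x)\<^sup>2 - 2 * w x * U x)) (at x)"
    and u: "(u has_real_derivative (0 - (u x)\<^sup>2 - 2 * w x * u x)) (at x)"
    and a: "(a has_real_derivative a') (at x)" "a x \<noteq> 0"
    and l: "l \<noteq> 0" "U x \<noteq> u x"
  shows "((\<lambda>x. 2 * l / a x / (U x - u x)) has_real_derivative
    (2 * l / a x - (2 * l / a x / (U x - u x))\<^sup>2
      - 2 * (a' / (2 * a x) - u x - w x) * (2 * l / a x / (U x - u x)))) (at x)"
proof -
  define n D A where "n = 2 * l / a x" and "D = U x - u x" and "A = a' / a x"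
  have D: "D \<noteq> 0" and U_eq: "U x = u x + D" using l by (auto simp: D_def)
  have n': "((\<lambda>x. 2 * l / a x) has_real_derivative - n * A) (at x)"
    by (rule derivative_eq_intros a refl)+ (simp add: n_def A_def)
  have D': "((\<lambda>x. U x - u x) has_real_derivative n - D * (2 * u x + D + 2 * w x)) (at x)"
    by (rule DERIV_cong[OF DERIV_diff[OF U[folded n_def] u]])
       (simp add: U_eq power2_eq_square algebra_simps)
  note DERIV_divide[OF n' D' D[unfolded D_def], folded n_def D_def]
  moreover have "(- n * A * D - n * (n - D * (2 * u x + D + 2 * w x))) / (D * D)
      = n - (n / D)\<^sup>2 - 2 * (A / 2 - u x - w x) * (n / D)"
    using D by (simp add: field_simps power2_eq_square)
  moreover have "A / 2 = a' / (2 * a x)" by (simp add: A_def)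
  ultimately show ?thesis by (simp only: n_def[symmetric] D_def[symmetric])
qed

text \<open>The next tail having a nonzero limit \<open>v\<close> at \<open>x0\<close> serves twice:
  some \<open>U l x0\<close> is nonzero, which gives the integrating factor, and the difference
  quotient of \<open>U\<close> in \<open>l\<close> has a nonzero limit, which gives the separation
  from \<open>u\<close>.\<close>

lemma riccati_local_step:
  fixes U :: "real \<Rightarrow> real \<Rightarrow> real" and u a w :: "real \<Rightarrow> real"
  assumes r: "r > 0" and \<delta>: "\<delta> > 0"
    and a: "\<And>x. x \<in> ball x0 r \<Longrightarrow> a x > 0" "\<And>x. x \<in> ball x0 r \<Longrightarrow> a differentiable (at x)"
    and sol: "\<And>l. 0 < l \<Longrightarrow> l < \<delta> \<Longrightarrow> riccati_solution (ball x0 r) w (\<lambda>x. 2 * l / a x) (U l)"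
    and lim: "\<And>x. x \<in> ball x0 r \<Longrightarrow> ((\<lambda>l. U l x) \<longlongrightarrow> u x) (at_right 0)"
    and lim1: "((\<lambda>l. 2 * l / a x0 / (U l x0 - u x0)) \<longlongrightarrow> v) (at_right 0)" "v \<noteq> 0"
  shows "\<exists>s>0. \<exists>e>0. riccati_solution (ball x0 s) w (\<lambda>x. 0) u \<and>
    (\<forall>l. 0 < l \<longrightarrow> l < e \<longrightarrow>
      riccati_solution (ball x0 s) (\<lambda>x. deriv a x / (2 * a x) - u x - w x)
        (\<lambda>x. 2 * l / a x) (\<lambda>x. 2 * l / a x / (U l x - u x)))"
proof -
  have x0r: "x0 \<in> ball x0 r" using r by simp
  have "\<forall>\<^sub>F l in at_right 0. 2 * l / a x0 / (U l x0 - u x0) \<noteq> 0"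
    by (rule tendsto_imp_eventually_ne[OF lim1])
  then have ne: "\<forall>\<^sub>F l in at_right 0. U l x0 \<noteq> u x0" by eventually_elim auto
  have "\<forall>\<^sub>F l in at_right 0. U l x0 \<noteq> 0"
    using ne tendsto_imp_eventually_ne[OF lim[OF x0r], of 0] by (cases "u x0 = 0") auto
  moreover have "\<forall>\<^sub>F l in at_right 0. l < \<delta> \<and> l > 0"
    using \<delta> by (auto simp: eventually_at_right_field)
  ultimately have "\<forall>\<^sub>F l in at_right 0. 0 < l \<and> l < \<delta> \<and> U l x0 \<noteq> 0"
    by eventually_elim auto
  \<comment> \<open>One parameter suffices: the equation \<open>p' = 2 w p\<close> does not involve
    \<open>l\<close>, so the factor found from \<open>U l0\<close> works for all
    \<open>l\<close>.\<close>
  then obtain l0 where l0: "0 < l0" "l0 < \<delta>" "U l0 x0 \<noteq> 0"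
    using eventually_happens[of _ "at_right (0::real)"] by auto
  have ac: "isCont a x" if "x \<in> ball x0 r" for x
    using a(2)[OF that] by (rule differentiable_imp_continuous_within)
  have "continuous_on (ball x0 r) (\<lambda>x. 2 * l0 / a x)"
    using a(1) by (intro continuous_intros continuous_at_imp_continuous_on ballI ac) force+
  with sol[OF l0(1,2)] l0(3) r obtain s p where s: "0 < s" "s \<le> r"
    and p: "\<And>x. x \<in> ball x0 s \<Longrightarrow> p x > 0"
      "\<And>x. x \<in> ball x0 s \<Longrightarrow> (p has_real_derivative 2 * w x * p x) (at x)"
    by (rule_tac riccati_integrating_factor[of r x0 w "\<lambda>x. 2 * l0 / a x" "U l0"]) auto
  define c d where "c = x0 - s / 2" and "d = x0 + s / 2"
  have cd: "c < x0" "x0 < d" using s by (auto simp: c_def d_def)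
  have sub: "x \<in> ball x0 s" "x \<in> ball x0 r" if "x \<in> {c..d}" for x
    using that s by (auto simp: c_def d_def dist_real_def abs_le_iff)
  \<comment> \<open>Multiplying by \<open>p\<close> absorbs the term with the arbitrary function
    \<open>w\<close> and leaves continuous coefficients.\<close>
  define V where "V = (\<lambda>l x. p x * U l x)"
  define V0 where "V0 = (\<lambda>x. p x * u x)"
  define h where "h = (\<lambda>x. 2 * p x / a x)"
  define k where "k = (\<lambda>x. 1 / p x)"
  have pc: "isCont p x" if "x \<in> ball x0 s" for x using p(2)[OF that] by (rule DERIV_isCont)
  have nz: "p x \<noteq> 0" "a x \<noteq> 0" if "x \<in> {c..d}" for x
    using p(1)[OF sub(1)[OF that]] a(1)[OF sub(2)[OF that]] by auto
  have h: "continuous_on {c..d} h"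
    unfolding h_def using nz sub
    by (intro continuous_intros continuous_at_imp_continuous_on ballI pc ac) auto
  have k: "continuous_on {c..d} k"
    unfolding k_def using nz sub
    by (intro continuous_intros continuous_at_imp_continuous_on ballI pc) auto
  have h0: "h x \<ge> 0" and k0: "k x \<ge> 0" if "x \<in> {c..d}" for x
    using p(1)[OF sub(1)[OF that]] a(1)[OF sub(2)[OF that]] by (auto simp: h_def k_def)
  have V: "(V l has_real_derivative (l * h x - k x * (V l x)\<^sup>2)) (at x)"
    if "0 < l" "l < \<delta>" "x \<in> {c..d}" for l x
    unfolding V_def h_def k_def
    by (rule derivative_eq_intros p(2)[OF sub(1)[OF that(3)]]
          riccati_solutionD[OF sol[OF that(1,2)] sub(2)[OF that(3)]] refl)+
       (use nz[OF that(3)] in \<open>simp add: field_simps power2_eq_square\<close>)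
  have V0lim: "((\<lambda>l. V l x) \<longlongrightarrow> V0 x) (at_right 0)" if "x \<in> {c..d}" for x
    unfolding V_def V0_def by (intro tendsto_intros lim sub(2)[OF that])
  have "c < d" using cd by simp
  note L = inhomogeneous_riccati_limit[OF \<open>c < d\<close> \<delta> h h0 k k0 V V0lim]
  obtain B e where e: "e > 0"
    and B: "\<And>l x. 0 < l \<Longrightarrow> l < e \<Longrightarrow> x \<in> {c..d} \<Longrightarrow> \<bar>V l x\<bar> \<le> B"
    using L(1) by blast
  have V0: "(V0 has_real_derivative (- k x * (V0 x)\<^sup>2)) (at x)" if "c < x" "x < d" for x
    using L(2) that by blast
  \<comment> \<open>The limit equation is known only on the open interval, while the separation
    argument asks for it on a closed one.\<close>
  define c' d' where "c' = (c + x0) / 2" and "d' = (d + x0) / 2"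
  have cd': "c' < x0" "x0 < d'" "c < c'" "d' < d" using cd by (auto simp: c'_def d'_def)
  then have sub': "{c'..d'} \<subseteq> {c..d}" by auto
  \<comment> \<open>With \<open>h = 2 p / a\<close>, this expression is
    \<open>p (U l - u) / l\<close> at \<open>x0\<close>.\<close>
  have "((\<lambda>l. h x0 / (2 * l / a x0 / (U l x0 - u x0))) \<longlongrightarrow> h x0 / v) (at_right 0)"
    by (intro tendsto_divide tendsto_const lim1)
  then have lim2: "((\<lambda>l. (V l x0 - V0 x0) / l) \<longlongrightarrow> h x0 / v) (at_right 0)"
    by (rule Lim_transform_eventually)
       (use a(1)[OF x0r] in \<open>auto simp: eventually_at_right_field V_def V0_def h_def field_simps intro!: exI[of _ 1]\<close>)
  have "h x0 / v \<noteq> 0" using nz[of x0] cd lim1(2) by (auto simp: h_def)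
  then have "\<exists>r'>0. \<exists>e'>0. \<forall>l x. 0 < l \<longrightarrow> l < e' \<longrightarrow> x \<in> ball x0 r' \<longrightarrow> V l x \<noteq> V0 x"
    using cd' e \<delta> sub'
    by (intro inhomogeneous_riccati_separation[of c' x0 d' "min \<delta> e" h k V V0 B "h x0 / v"]
          continuous_on_subset[OF h] continuous_on_subset[OF k] V V0 B lim2) auto
  then obtain r' e' where r': "r' > 0" "e' > 0"
    and sep: "\<And>l x. 0 < l \<Longrightarrow> l < e' \<Longrightarrow> x \<in> ball x0 r' \<Longrightarrow> V l x \<noteq> V0 x" by blast
  define t where "t = min (s / 2) r'"
  have t: "t > 0" using r' s by (simp add: t_def)
  have tb: "c < x" "x < d" "x \<in> {c..d}" "x \<in> ball x0 r'" if "x \<in> ball x0 t" for x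
  proof -
    have "\<bar>x0 - x\<bar> < s / 2" "\<bar>x0 - x\<bar> < r'" using that by (auto simp: t_def dist_real_def)
    then show "c < x" "x < d" "x \<in> ball x0 r'"
      unfolding c_def d_def by (linarith, linarith, simp add: dist_real_def)
    then show "x \<in> {c..d}" by simp
  qed
  have usol: "riccati_solution (ball x0 t) w (\<lambda>x. 0) u"
  proof (rule riccati_solutionI)
    fix x assume x: "x \<in> ball x0 t"
    note px = p(2)[OF sub(1)[OF tb(3)[OF x]]] nz(1)[OF tb(3)[OF x]]
    have "((\<lambda>x. V0 x / p x) has_real_derivative (0 - (u x)\<^sup>2 - 2 * w x * u x)) (at x)"
      by (rule derivative_eq_intros V0 tb x px refl)+
         (use px(2) in \<open>simp add: V0_def k_def field_simps power2_eq_square\<close>)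
    then show "(u has_real_derivative (0 - (u x)\<^sup>2 - 2 * w x * u x)) (at x)"
      by (rule has_field_derivative_transform_within_open[of _ _ _ "ball x0 t"])
         (use x nz(1)[OF tb(3)] in \<open>auto simp: V0_def\<close>)
  qed
  have "riccati_solution (ball x0 t) (\<lambda>x. deriv a x / (2 * a x) - u x - w x)
        (\<lambda>x. 2 * l / a x) (\<lambda>x. 2 * l / a x / (U l x - u x))"
    if l: "0 < l" "l < min \<delta> e'" for l
  proof (rule riccati_solutionI, rule riccati_tail_derivative)
    fix x assume x: "x \<in> ball x0 t"
    show "(U l has_real_derivative 2 * l / a x - (U l x)\<^sup>2 - 2 * w x * U l x) (at x)"
      using riccati_solutionD[OF sol sub(2)[OF tb(3)[OF x]]] l by simp
    show "(u has_real_derivative 0 - (u x)\<^sup>2 - 2 * w x * u x) (at x)"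
      by (rule riccati_solutionD[OF usol x])
    show "(a has_real_derivative deriv a x) (at x)"
      using a(2)[OF sub(2)[OF tb(3)[OF x]]] by (simp add: DERIV_deriv_iff_real_differentiable)
    show "a x \<noteq> 0" by (rule nz(2)[OF tb(3)[OF x]])
    show "l \<noteq> 0" "U l x \<noteq> u x"
      using l sep[of l x] tb(4)[OF x] by (auto simp: V_def V0_def)
  qed
  moreover have "min \<delta> e' > 0" using \<delta> r' by simp
  ultimately show ?thesis using t usol by blast
qed

section \<open>Proof of the theorem\<close>

lemma cf_expressible_tail_tendsto:
  assumes "cf_expressible I a u U" "x \<in> I" "a x > 0"
  shows "((\<lambda>l. cf_tail (\<lambda>n. u n x) (2 * l / a x) (U x l) n) \<longlongrightarrow> u n x) (at_right 0)"
    and "u (Suc n) x \<noteq> 0"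
proof -
  let ?c = "\<lambda>n. u n x"
  have "\<forall>\<^sub>F l in at_right 0. \<forall>N. cf_trunc_defined ?c (2 * l / a x) N"
    using assms unfolding cf_expressible_def by blast
  then obtain \<delta> where \<delta>: "\<delta> > 0"
    and def: "\<And>l N. 0 < l \<Longrightarrow> l < \<delta> \<Longrightarrow> cf_trunc_defined ?c (2 * l / a x) N"
    by (auto simp: eventually_at_right_field)
  \<comment> \<open>The image of the threshold \<open>\<delta>\<close> under the substitution
    \<open>z = 2 * l / a x\<close>.\<close>
  define d where "d = 2 * \<delta> / a x"
  have d: "d > 0" using \<delta> assms(3) by (simp add: d_def)
  have nz: "cf_trunc (\<lambda>n. ?c (n + Suc k)) z N \<noteq> 0" if "0 < z" "z < d" for z k N
  proof (rule cf_trunc_tail_nonzero)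
    show "\<forall>N. cf_trunc_defined ?c z N"
      using def[of "z * a x / 2"] that assms(3) by (auto simp: d_def field_simps)
  qed
  have nz0: "?c (Suc k) \<noteq> 0" for k using nz[of "d / 2" k 0] d by simp
  then show "u (Suc n) x \<noteq> 0" .
  \<comment> \<open>Definedness concerns only \<open>z > 0\<close>. At \<open>z = 0\<close> a
    truncation is its leading coefficient, which is also its truncation of order 0 at
    \<open>d / 2\<close>.\<close>
  have "cf_trunc (\<lambda>n. ?c (Suc (n + k))) z N \<noteq> 0" if "0 \<le> z" "z < d" for z k N
    using nz[of z k N] nz0[of k] that by (cases "z = 0") (auto simp: cf_trunc_0)
  then have cf: "cf_nonzero (\<lambda>n. ?c (Suc n)) d"
    unfolding cf_nonzero_def by simp
  have conv: "(\<lambda>N. cf_trunc ?c z N) \<longlonglongrightarrow> U x (z * a x / 2)" if "0 < z" for z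
  proof -
    have "cf_has_value ?c (2 * (z * a x / 2) / a x) (U x (z * a x / 2))"
      using assms that unfolding cf_expressible_def by (meson half_gt_zero mult_pos_pos)
    then show ?thesis using assms(3) unfolding cf_has_value_def by simp
  qed
  have z: "filterlim (\<lambda>l. 2 * l / a x) (at_right 0) (at_right 0)"
    unfolding filterlim_at using assms(3)
    by (auto intro!: tendsto_eq_intros simp: eventually_at_right_field intro!: exI[of _ 1])
  have "((\<lambda>z. cf_tail ?c z (U x (z * a x / 2)) n) \<longlongrightarrow> ?c n) (at_right 0)"
    by (rule cf_tail_tendsto_coeff[OF d cf]) (rule conv)
  from filterlim_compose[OF this z]
  show "((\<lambda>l. cf_tail ?c (2 * l / a x) (U x l) n) \<longlongrightarrow> ?c n) (at_right 0)"
    using assms(3) by simp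
qed

theorem theorem2:
  fixes I :: "real set" and a W' :: "real \<Rightarrow> real"
    and U :: "real \<Rightarrow> real \<Rightarrow> real" and u :: "nat \<Rightarrow> real \<Rightarrow> real"
  assumes "open I" and "is_interval I"
    and "\<And>x. x \<in> I \<Longrightarrow> a x > 0"
    and "\<And>x. x \<in> I \<Longrightarrow> a differentiable (at x)"
    and "\<And>l. l > 0 \<Longrightarrow> riccati_solution I W' (\<lambda>x. 2 * l / a x) (\<lambda>x. U x l)"
    and "cf_expressible I a u U"
  shows "\<forall>n. riccati_solution I (W_seq a W' u n) (\<lambda>x. 0) (u n)"
proof -
  let ?U = "\<lambda>n l x. cf_tail (\<lambda>n. u n x) (2 * l / a x) (U x l) n"
  note T = cf_expressible_tail_tendsto[OF assms(6)]
  have step: "\<exists>s>0. \<exists>e>0. riccati_solution (ball x0 s) (W_seq a W' u n) (\<lambda>x. 0) (u n) \<and>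
      (\<forall>l. 0 < l \<longrightarrow> l < e \<longrightarrow>
        riccati_solution (ball x0 s) (W_seq a W' u (Suc n)) (\<lambda>x. 2 * l / a x) (?U (Suc n) l))"
    if x0: "x0 \<in> I" and s: "s > 0" and e: "e > 0"
      and sol: "\<And>l. 0 < l \<Longrightarrow> l < e \<Longrightarrow> riccati_solution (ball x0 s) (W_seq a W' u n) (\<lambda>x. 2 * l / a x) (?U n l)"
    for x0 s e n
  proof -
    obtain r where r: "r > 0" "ball x0 r \<subseteq> I" by (rule openE[OF assms(1) x0])
    have sub: "x \<in> ball x0 s" "x \<in> I" if "x \<in> ball x0 (min r s)" for x using that r by auto
    have W: "W_seq a W' u (Suc n) = (\<lambda>x. deriv a x / (2 * a x) - u n x - W_seq a W' u n x)"
      by (rule ext) simp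
    have "\<exists>s'>0. \<exists>e'>0. riccati_solution (ball x0 s') (W_seq a W' u n) (\<lambda>x. 0) (u n) \<and>
      (\<forall>l. 0 < l \<longrightarrow> l < e' \<longrightarrow>
        riccati_solution (ball x0 s') (\<lambda>x. deriv a x / (2 * a x) - u n x - W_seq a W' u n x)
          (\<lambda>x. 2 * l / a x) (\<lambda>x. 2 * l / a x / (?U n l x - u n x)))"
    proof (rule riccati_local_step[where r = "min r s" and \<delta> = e and v = "u (Suc n) x0"])
      show "min r s > 0" "e > 0" using r s e by auto
      show "a x > 0" "a differentiable (at x)" if "x \<in> ball x0 (min r s)" for x
        using assms(3,4) sub(2)[OF that] by auto
      show "riccati_solution (ball x0 (min r s)) (W_seq a W' u n) (\<lambda>x. 2 * l / a x) (?U n l)"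
        if "0 < l" "l < e" for l
        using sol[OF that] sub(1) unfolding riccati_solution_def by blast
      show "((\<lambda>l. ?U n l x) \<longlongrightarrow> u n x) (at_right 0)" if "x \<in> ball x0 (min r s)" for x
        using T(1) assms(3) sub(2)[OF that] by blast
      show "((\<lambda>l. 2 * l / a x0 / (?U n l x0 - u n x0)) \<longlongrightarrow> u (Suc n) x0) (at_right 0)"
        using T(1)[OF x0 assms(3)[OF x0], of "Suc n"] by simp
      show "u (Suc n) x0 \<noteq> 0" by (rule T(2)[OF x0 assms(3)[OF x0]])
    qed
    then show ?thesis unfolding W cf_tail.simps .
  qed
  \<comment> \<open>The radius \<open>s\<close> and the range \<open>e\<close> of parameters depend
    on \<open>x0\<close> and may shrink with \<open>n\<close>, which is harmless as each
    \<open>n\<close> is treated separately.\<close>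
  have tail: "\<exists>s>0. \<exists>e>0. \<forall>l. 0 < l \<longrightarrow> l < e \<longrightarrow>
      riccati_solution (ball x0 s) (W_seq a W' u n) (\<lambda>x. 2 * l / a x) (?U n l)"
    if x0: "x0 \<in> I" for x0 n
  proof (induction n)
    case 0
    obtain r where r: "r > 0" "ball x0 r \<subseteq> I" by (rule openE[OF assms(1) x0])
    have "riccati_solution (ball x0 r) (W_seq a W' u 0) (\<lambda>x. 2 * l / a x) (?U 0 l)" if "l > 0" for l
      using assms(5)[OF that] r(2) unfolding riccati_solution_def by auto
    then show ?case
      by (intro exI[of _ r] conjI[OF r(1)] exI[of _ "1 :: real"] conjI[OF zero_less_one]) blast
  next
    case (Suc n)
    then obtain s e where se: "s > 0" "e > 0"
      and sol: "\<And>l. 0 < l \<Longrightarrow> l < e \<Longrightarrow>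
        riccati_solution (ball x0 s) (W_seq a W' u n) (\<lambda>x. 2 * l / a x) (?U n l)" by blast
    from step[OF x0 se sol] show ?case by blast
  qed
  show ?thesis
  proof
    fix n
    have "\<exists>s>0. riccati_solution (ball x s) (W_seq a W' u n) (\<lambda>x. 0) (u n)" if x: "x \<in> I" for x
    proof -
      obtain s e where se: "s > 0" "e > 0"
        and sol: "\<And>l. 0 < l \<Longrightarrow> l < e \<Longrightarrow>
          riccati_solution (ball x s) (W_seq a W' u n) (\<lambda>x. 2 * l / a x) (?U n l)"
        using tail[OF x, of n] by blast
      from step[OF x se sol] show ?thesis by blast
    qed
    \<comment> \<open>Differentiability and the equation are conditions at single points, so they
      are read off at the centre of each ball.\<close>
    then show "riccati_solution I (W_seq a W' u n) (\<lambda>x. 0) (u n)"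
      unfolding riccati_solution_def by (meson centre_in_ball)
  qed
qed

end
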